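(* Let $K>0$, let $S=\{1,\dots,n\}$ be a finite set of sites with a symmetric graph without loops, and let $\partial i$ be the set of neighbours of $i$. Let $\{a_i,b_i : i\in S\}$ be real numbers and let $$\beta_{ij}=\begin{pmatrix} c_{ij}&d_{ij}\\ f_{ij}&e_{ij}\end{pmatrix}\quad(i\ne j)$$ be real matrices with $\beta_{ij}=\beta_{ji}^{\mathrm T}$ and $\beta_{ij}=0$ when $i,j$ are not neighbours. Consider on $[0,K]^n$ the mixed auto-model with mixed truncated exponential conditionals having energy function $$Q(x)=\sum_{i\in S}(a_i,b_i)B(x_i)+\sum_{\{i,j\}}B(x_i)^{\mathrm T}\beta_{ij}B(x_j),\qquad B(x)=\bigl(1_{(0,K]}(x),\,-x\,1_{(0,K]}(x)\bigr)^{\mathrm T},$$ where the second sum is over unordered pairs of neighbouring sites. Assume that for all $i\in S$, $$b_i+\sum_{j\in\partial i}\min(0,\,f_{ij},\,f_{ij}-e_{ij}K)>0 .$$ Then: (i) The model is well-defined. (ii) If $d_{ij}\le 0$ and $e_{ij}\ge 0$ for all $i\neq j$ in $S$, the model is spatially cooperative. (iii) If $d_{ij}\ge 0$ and $e_{ij}\le 0$ for all $i\neq j$ in $S$, the model is spatially competitive.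
   Context: State space: $E=\{0\}\cup(0,K]$ with reference measure $m=\delta_0+\lambda$, with $\delta_0$ the Dirac mass at $0$ and $\lambda$ Lebesgue measure on $E$; $E^S$ carries the product measure $\nu=m^{\otimes S}$. The random field $X=(X_i)_{i\in S}$ has density $P(x)=Z^{-1}e^{Q(x)}$ with respect to $\nu$. A mixed truncated exponential distribution with parameters $\gamma\in(0,1)$ and $\lambda>0$ is the distribution on $E$ with density with respect to $m$ $$\gamma 1_{\{0\}}(x)+(1-\gamma)\frac{\lambda}{1-e^{-\lambda K}}e^{-\lambda x}1_{(0,K]}(x).$$ It is an exponential family with sufficient statistic $B$ and natural parameter $\theta=(\theta_1,\theta_2)$, where $\theta_2=\lambda$, $\theta_1=\log\frac{(1-\gamma)\lambda}{\gamma(1-e^{-\lambda K})}$, and $\gamma=\theta_2/(\theta_2+e^{\theta_1}(1-e^{-\theta_2K}))$. In the model, the conditional density of $X_i$ given $x^i=(x_j)_{j\neq i}$ is proportional to $\exp\langle\theta_i(x_{\partial i}),B(x_i)\rangle$ with $$\theta_{i,1}(x_{\partial i})=a_i+\sum_{j\in\partial i}\{c_{ij}1_{(0,K]}(x_j)-d_{ij}x_j1_{(0,K]}(x_j)\},$$ $$\theta_{i,2}(x_{\partial i})=b_i+\sum_{j\in\partial i}\{f_{ij}1_{(0,K]}(x_j)-e_{ij}x_j1_{(0,K]}(x_j)\}.$$ "Well-defined" means: $e^Q$ is $\nu$-integrable, and $\theta_{i,2}(x_{\partial i})>0$ for all $i\in S$ and all values of $x_{\partial i}$ (so that each local conditional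 is a mixed truncated exponential distribution with $\lambda_i=\theta_{i,2}>0$ and $\gamma_i\in(0,1)$). Let $R_i(x^i)=E[X_i1_{(0,K]}(X_i)\mid x^i]$. The model is spatially cooperative (respectively, competitive) if for every $i\in S$ and every $j\in\partial i$, with the other coordinates of $x^i$ held fixed at arbitrary values in $E$, $R_i(x^i)$ is nondecreasing (respectively, nonincreasing) as a function of $x_j\in(0,K]$. *)

theory Defs
  imports "HOL-Probability.Probability"
begin

text \<open>
  The state space is \<open>E = {0} \<union> (0, K] = {0..K}\<close>.  The reference measure on it is the sum of the
  Dirac measure at \<open>0\<close> and Lebesgue measure; \<open>emeasure_ref_measure\<close> below shows that
  \<^const>\<open>measure_of\<close> does not degenerate here.
\<close>

definition ref_measure :: "real \<Rightarrow> real measure" where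
  "ref_measure K =
     measure_of {0..K} (sets (restrict_space borel {0..K}))
       (\<lambda>A. emeasure (return (restrict_space borel {0..K}) 0) A
          + emeasure (restrict_space lborel {0..K}) A)"

lemma space_ref_measure [simp]: "space (ref_measure K) = {0..K}"
  unfolding ref_measure_def by (rule space_measure_of) (auto simp: sets_restrict_space)

lemma sets_ref_measure [simp, measurable_cong]:
  "sets (ref_measure K) = sets (restrict_space borel {0..K})"
  unfolding ref_measure_def
  using sets.sets_measure_of_eq[of "restrict_space borel {0..K::real}"]
  by (simp add: space_restrict_space)

lemma emeasure_ref_measure:
  assumes "A \<in> sets (ref_measure K)"
  shows "emeasure (ref_measure K) A = indicator A 0 + emeasure lborel A"
proof -
  let ?M = "restrict_space borel {0..K}"
  let ?D = "return ?M 0" and ?L = "restrict_space lborel {0..K}"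
  let ?\<mu> = "\<lambda>A. emeasure ?D A + emeasure ?L A"
  have A: "A \<in> sets ?M" using assms by simp
  have sD: "sets ?D = sets ?M" and sL: "sets ?L = sets ?M"
    by (simp_all add: sets_restrict_space)
  have "emeasure (ref_measure K) A = ?\<mu> A"
  proof (rule emeasure_measure_of[OF ref_measure_def])
    show "sets ?M \<subseteq> Pow {0..K}" by (auto simp: sets_restrict_space)
    show "A \<in> sets (ref_measure K)" by fact
    show "positive (sets (ref_measure K)) ?\<mu>" by (simp add: positive_def)
    show "countably_additive (sets (ref_measure K)) ?\<mu>"
    proof (rule countably_additiveI)
      fix F :: "nat \<Rightarrow> real set"
      assume F: "range F \<subseteq> sets (ref_measure K)" "disjoint_family F"
      have "(\<Sum>i. emeasure ?D (F i)) = emeasure ?D (\<Union>i. F i)"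
        by (rule suminf_emeasure) (use F sD in auto)
      moreover have "(\<Sum>i. emeasure ?L (F i)) = emeasure ?L (\<Union>i. F i)"
        by (rule suminf_emeasure) (use F sL in auto)
      ultimately show "(\<Sum>i. ?\<mu> (F i)) = ?\<mu> (\<Union>i. F i)"
        by (simp add: suminf_add[symmetric])
    qed
  qed
  also have "\<dots> = indicator A 0 + emeasure lborel A"
    using A by (subst emeasure_restrict_space)
      (auto simp: sets_restrict_space emeasure_return[of A ?M])
  finally show ?thesis .
qed

lemma finite_measure_ref_measure: "finite_measure (ref_measure K)"
proof
  have "{0..K} \<in> sets (ref_measure K)"
    using sets.top[of "ref_measure K"] by simp
  then show "emeasure (ref_measure K) (space (ref_measure K)) \<noteq> \<infinity>"
    by (simp add: emeasure_ref_measure emeasure_lborel_Icc_eq indicator_def)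
qed

definition product_ref_measure :: "real \<Rightarrow> nat set \<Rightarrow> (nat \<Rightarrow> real) measure" where
  "product_ref_measure K S = PiM S (\<lambda>_. ref_measure K)"

definition neighbours :: "(nat \<times> nat) set \<Rightarrow> nat \<Rightarrow> nat set" where
  "neighbours G i = {j. (i, j) \<in> G}"

definition suff_stat :: "real \<Rightarrow> real \<Rightarrow> real^2" where
  "suff_stat K x = vector [indicator {0<..K} x, - x * indicator {0<..K} x]"

text \<open>
  An edge relation \<open>G\<close> is symmetric and irreflexive; each unordered pair of neighbours is
  represented by its increasingly ordered pair.
\<close>

definition energy ::
  "real \<Rightarrow> nat set \<Rightarrow> (nat \<times> nat) set \<Rightarrow> (nat \<Rightarrow> real) \<Rightarrow> (nat \<Rightarrow> real)
    \<Rightarrow> (nat \<Rightarrow> nat \<Rightarrow> real^2^2) \<Rightarrow> (nat \<Rightarrow> real) \<Rightarrow> real" where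
  "energy K S G a b \<beta> x =
     (\<Sum>i\<in>S. vector [a i, b i] \<bullet> suff_stat K (x i))
   + (\<Sum>(i, j) \<in> {(i, j). i \<in> S \<and> j \<in> S \<and> (i, j) \<in> G \<and> i < j}.
        suff_stat K (x i) \<bullet> (\<beta> i j *v suff_stat K (x j)))"

definition local_param ::
  "real \<Rightarrow> (nat \<times> nat) set \<Rightarrow> (nat \<Rightarrow> real) \<Rightarrow> (nat \<Rightarrow> real)
    \<Rightarrow> (nat \<Rightarrow> nat \<Rightarrow> real^2^2) \<Rightarrow> nat \<Rightarrow> (nat \<Rightarrow> real) \<Rightarrow> real^2" where
  "local_param K G a b \<beta> i x = vector
     [a i + (\<Sum>j\<in>neighbours G i. \<beta> i j $ 1 $ 1 * indicator {0<..K} (x j)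
                              - \<beta> i j $ 1 $ 2 * x j * indicator {0<..K} (x j)),
      b i + (\<Sum>j\<in>neighbours G i. \<beta> i j $ 2 $ 1 * indicator {0<..K} (x j)
                              - \<beta> i j $ 2 $ 2 * x j * indicator {0<..K} (x j))]"

text \<open>
  As a function of the \<open>i\<close>-th coordinate alone, the energy is \<open>\<langle>local_param, suff_stat\<rangle>\<close> up to an
  additive constant.
\<close>

lemma energy_fun_upd:
  assumes fin: "finite S" and i: "i \<in> S"
    and G: "G \<subseteq> S \<times> S" "sym G" "irrefl G"
    and tr: "\<And>i j. i \<in> S \<Longrightarrow> j \<in> S \<Longrightarrow> i \<noteq> j \<Longrightarrow> \<beta> i j = transpose (\<beta> j i)"
  shows "energy K S G a b \<beta> (x(i := y)) - energy K S G a b \<beta> (x(i := 0))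
       = local_param K G a b \<beta> i x \<bullet> suff_stat K y"
proof -
  let ?B = "suff_stat K"
  let ?x = "\<lambda>y. x(i := y)"
  let ?P = "{(k, j). k \<in> S \<and> j \<in> S \<and> (k, j) \<in> G \<and> k < j}"
  let ?g = "\<lambda>y (k, j). ?B (?x y k) \<bullet> (\<beta> k j *v ?B (?x y j))"
  let ?N = "neighbours G i"
  have B0: "?B 0 = 0"
    by (simp add: suff_stat_def vec_eq_iff forall_2)
  have N: "?N \<subseteq> S - {i}" "finite ?N"
    using G fin by (auto simp: neighbours_def irrefl_def intro: finite_subset[of _ S])
  have finP: "finite ?P"
    by (rule finite_subset[of _ "S \<times> S"]) (use fin in auto)
  define e where "e j = (if i < j then (i, j) else (j, i))" for j
  have inj: "inj_on e ?N"
    by (auto simp: e_def inj_on_def split: if_splits)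
  have sub: "e ` ?N \<subseteq> ?P"
    using N G i by (auto simp: e_def neighbours_def sym_def)
  have out: "p \<in> ?P - e ` ?N \<Longrightarrow> ?g y p = ?g 0 p" for p
  proof -
    assume p: "p \<in> ?P - e ` ?N"
    obtain k j where kj: "p = (k, j)" by (cases p)
    have "k \<noteq> i"
    proof
      assume "k = i"
      then have "j \<in> ?N" "e j = p" using p kj by (auto simp: neighbours_def e_def)
      then show False using p by blast
    qed
    moreover have "j \<noteq> i"
    proof
      assume "j = i"
      then have "k \<in> ?N" "e k = p"
        using p kj G(2) by (auto simp: neighbours_def e_def sym_def)
      then show False using p by blast
    qed
    ultimately show ?thesis using kj by simp
  qed
  have val: "?g y (e j) - ?g 0 (e j) = (\<beta> i j *v ?B (x j)) \<bullet> ?B y" if j: "j \<in> ?N" for j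
  proof -
    have ji: "j \<noteq> i" "j \<in> S" using N j by auto
    have "\<beta> j i = transpose (\<beta> i j)" using tr[of j i] ji i by simp
    then have "?B (x j) \<bullet> (\<beta> j i *v ?B y) = (\<beta> i j *v ?B (x j)) \<bullet> ?B y"
      by (metis dot_lmul_matrix inner_commute transpose_matrix_vector)
    then show ?thesis using ji by (auto simp: e_def B0 inner_commute)
  qed
  have "(\<Sum>p\<in>?P. ?g y p) - (\<Sum>p\<in>?P. ?g 0 p) = (\<Sum>p\<in>?P. ?g y p - ?g 0 p)"
    by (rule sum_subtractf[symmetric])
  also have "\<dots> = (\<Sum>p\<in>e ` ?N. ?g y p - ?g 0 p)"
    by (rule sum.mono_neutral_right[OF finP sub]) (use out in auto)
  also have "\<dots> = (\<Sum>j\<in>?N. ?g y (e j) - ?g 0 (e j))"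
    by (subst sum.reindex[OF inj]) simp
  also have "\<dots> = (\<Sum>j\<in>?N. (\<beta> i j *v ?B (x j)) \<bullet> ?B y)"
    by (rule sum.cong) (use val in auto)
  finally have pairs: "(\<Sum>p\<in>?P. ?g y p) - (\<Sum>p\<in>?P. ?g 0 p)
      = (\<Sum>j\<in>?N. \<beta> i j *v ?B (x j)) \<bullet> ?B y"
    by (simp add: inner_sum_left)
  have singles: "(\<Sum>k\<in>S. vector [a k, b k] \<bullet> ?B (?x y k)) - (\<Sum>k\<in>S. vector [a k, b k] \<bullet> ?B (?x 0 k))
      = (vector [a i, b i] :: real^2) \<bullet> ?B y"
    by (simp add: sum.remove[OF fin i] B0)
  have "local_param K G a b \<beta> i x = vector [a i, b i] + (\<Sum>j\<in>?N. \<beta> i j *v ?B (x j))"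
    by (simp add: local_param_def vec_eq_iff forall_2 matrix_vector_mult_def sum_2 suff_stat_def
        algebra_simps)
  then show ?thesis
    using singles pairs unfolding energy_def by (simp add: inner_add_left)
qed

definition well_defined_model ::
  "real \<Rightarrow> nat set \<Rightarrow> (nat \<times> nat) set \<Rightarrow> (nat \<Rightarrow> real) \<Rightarrow> (nat \<Rightarrow> real)
    \<Rightarrow> (nat \<Rightarrow> nat \<Rightarrow> real^2^2) \<Rightarrow> bool" where
  "well_defined_model K S G a b \<beta> \<longleftrightarrow>
     integrable (product_ref_measure K S) (\<lambda>x. exp (energy K S G a b \<beta> x)) \<and>
     (\<forall>i\<in>S. \<forall>x \<in> S \<rightarrow>\<^sub>E {0..K}. local_param K G a b \<beta> i x $ 2 > 0)"

definition joint_density ::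
  "real \<Rightarrow> nat set \<Rightarrow> (nat \<times> nat) set \<Rightarrow> (nat \<Rightarrow> real) \<Rightarrow> (nat \<Rightarrow> real)
    \<Rightarrow> (nat \<Rightarrow> nat \<Rightarrow> real^2^2) \<Rightarrow> (nat \<Rightarrow> real) \<Rightarrow> real" where
  "joint_density K S G a b \<beta> x = exp (energy K S G a b \<beta> x)
     / (LINT z|product_ref_measure K S. exp (energy K S G a b \<beta> z))"

text \<open>
  The conditional density of the \<open>i\<close>-th coordinate at \<open>y\<close> given the other coordinates of \<open>x\<close>;
  it does not depend on \<open>x i\<close>.
\<close>

definition cond_density ::
  "real \<Rightarrow> nat set \<Rightarrow> (nat \<times> nat) set \<Rightarrow> (nat \<Rightarrow> real) \<Rightarrow> (nat \<Rightarrow> real)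
    \<Rightarrow> (nat \<Rightarrow> nat \<Rightarrow> real^2^2) \<Rightarrow> nat \<Rightarrow> (nat \<Rightarrow> real) \<Rightarrow> real \<Rightarrow> real" where
  "cond_density K S G a b \<beta> i x y = joint_density K S G a b \<beta> (x(i := y))
     / (LINT z|ref_measure K. joint_density K S G a b \<beta> (x(i := z)))"

definition cond_mean ::
  "real \<Rightarrow> nat set \<Rightarrow> (nat \<times> nat) set \<Rightarrow> (nat \<Rightarrow> real) \<Rightarrow> (nat \<Rightarrow> real)
    \<Rightarrow> (nat \<Rightarrow> nat \<Rightarrow> real^2^2) \<Rightarrow> nat \<Rightarrow> (nat \<Rightarrow> real) \<Rightarrow> real" where
  "cond_mean K S G a b \<beta> i x =
     (LINT y|ref_measure K. y * indicator {0<..K} y * cond_density K S G a b \<beta> i x y)"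

definition spatially_cooperative ::
  "real \<Rightarrow> nat set \<Rightarrow> (nat \<times> nat) set \<Rightarrow> (nat \<Rightarrow> real) \<Rightarrow> (nat \<Rightarrow> real)
    \<Rightarrow> (nat \<Rightarrow> nat \<Rightarrow> real^2^2) \<Rightarrow> bool" where
  "spatially_cooperative K S G a b \<beta> \<longleftrightarrow>
     (\<forall>i\<in>S. \<forall>j\<in>neighbours G i. \<forall>x \<in> S \<rightarrow>\<^sub>E {0..K}.
        mono_on {0<..K} (\<lambda>u. cond_mean K S G a b \<beta> i (x(j := u))))"

definition spatially_competitive ::
  "real \<Rightarrow> nat set \<Rightarrow> (nat \<times> nat) set \<Rightarrow> (nat \<Rightarrow> real) \<Rightarrow> (nat \<Rightarrow> real)
    \<Rightarrow> (nat \<Rightarrow> nat \<Rightarrow> real^2^2) \<Rightarrow> bool" where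
  "spatially_competitive K S G a b \<beta> \<longleftrightarrow>
     (\<forall>i\<in>S. \<forall>j\<in>neighbours G i. \<forall>x \<in> S \<rightarrow>\<^sub>E {0..K}.
        antimono_on {0<..K} (\<lambda>u. cond_mean K S G a b \<beta> i (x(j := u))))"

end

theory Submission
  imports Defs
begin

text \<open>
  Moving \<open>x\<^sub>j\<close> changes the \<open>i\<close>-th conditional law only through its natural parameter, and the density
  of one such law with respect to another is \<open>exp ((\<theta>' - \<theta>) \<bullet> B)\<close>.  When \<open>\<theta>\<^sub>1 \<le> \<theta>'\<^sub>1\<close> and
  \<open>\<theta>'\<^sub>2 \<le> \<theta>\<^sub>2\<close> this is a nondecreasing function on \<open>{0..K}\<close>, so by Chebyshev's association inequality
  the mean under \<open>\<theta>'\<close> is at least the mean under \<open>\<theta>\<close>.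
\<close>

lemma weighted_mean_mono:
  fixes M :: "real measure" and h w :: "real \<Rightarrow> real"
  assumes sp: "space M \<subseteq> {p..q}"
    and h0: "\<And>x. x \<in> space M \<Longrightarrow> 0 \<le> h x"
    and w: "mono_on {p..q} w"
    and int: "integrable M h" "integrable M (\<lambda>x. x * h x)"
      "integrable M (\<lambda>x. h x * w x)" "integrable M (\<lambda>x. x * (h x * w x))"
    and pos: "0 < (LINT x|M. h x)" "0 < (LINT x|M. h x * w x)"
  shows "(LINT x|M. x * h x) / (LINT x|M. h x)
       \<le> (LINT x|M. x * (h x * w x)) / (LINT x|M. h x * w x)"
proof -
  define m where "m = (LINT x|M. x * h x) / (LINT x|M. h x)"
  have mean: "(LINT x|M. x * h x) = m * (LINT x|M. h x)"
    using pos by (simp add: m_def)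
  \<comment> \<open>The weighted mean \<open>m\<close> has to lie in \<open>{p..q}\<close>, because
    \<open>w\<close> is known to be monotone only there and is evaluated at \<open>m\<close>
    below.\<close>
  have "p * (LINT x|M. h x) \<le> (LINT x|M. x * h x)"
    unfolding integral_mult_right_zero[symmetric]
    by (rule integral_mono) (use int h0 sp in \<open>auto intro!: mult_right_mono\<close>)
  moreover have "(LINT x|M. x * h x) \<le> q * (LINT x|M. h x)"
    unfolding integral_mult_right_zero[symmetric]
    by (rule integral_mono) (use int h0 sp in \<open>auto intro!: mult_right_mono\<close>)
  ultimately have m: "m \<in> {p..q}"
    using pos by (simp add: m_def field_simps)
  \<comment> \<open>Both factors change sign at \<open>m\<close>. Taking the mean itself as pivot
    replaces the usual double integral over pairs of points by a single integral.\<close>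
  have sign: "0 \<le> (x - m) * (w x - w m)" if "x \<in> {p..q}" for x
    using monotone_onD[OF w that m] monotone_onD[OF w m that]
    by (cases "x \<le> m") (auto intro: mult_nonneg_nonneg mult_nonpos_nonpos)
  have "0 \<le> (LINT x|M. h x * ((x - m) * (w x - w m)))"
    by (intro Bochner_Integration.integral_nonneg mult_nonneg_nonneg[OF h0 sign]) (use sp in auto)
  also have "\<dots> = (LINT x|M. x * (h x * w x) - m * (h x * w x) - w m * (x * h x) + m * w m * h x)"
    by (intro Bochner_Integration.integral_cong refl) (simp add: algebra_simps)
  \<comment> \<open>By \<open>mean\<close>, the two terms containing \<open>w m\<close> cancel after
    integration.\<close>
  also have "\<dots> = (LINT x|M. x * (h x * w x)) - m * (LINT x|M. h x * w x)"
    using int by (simp add: mean)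
  finally show ?thesis
    using pos by (simp add: m_def[symmetric] field_simps)
qed

section \<open>Exponential tilts of the one-site reference measure\<close>

lemma inner_suff_stat:
  "\<theta> \<bullet> suff_stat K y = (\<theta> $ 1 - \<theta> $ 2 * y) * indicator {0<..K} y"
  by (simp add: suff_stat_def inner_vec_def sum_2 algebra_simps)

lemma norm_suff_stat_le:
  assumes "y \<in> {0..K}"
  shows "norm (suff_stat K y) \<le> 1 + K"
proof -
  have "norm (suff_stat K y) \<le> \<bar>suff_stat K y $ 1\<bar> + \<bar>suff_stat K y $ 2\<bar>"
    using norm_le_l1_cart[of "suff_stat K y"] by (simp add: sum_2)
  also have "\<dots> \<le> 1 + K"
    using assms by (auto simp: suff_stat_def indicator_def)
  finally show ?thesis .
qed

lemma measurable_suff_stat_component [measurable]: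
  "(\<lambda>y. suff_stat K y $ 1) \<in> borel_measurable borel"
  "(\<lambda>y. suff_stat K y $ 2) \<in> borel_measurable borel"
  unfolding suff_stat_def vector_2 by measurable

lemma measurable_ref_measure_borel:
  fixes f :: "real \<Rightarrow> real"
  assumes "f \<in> borel_measurable borel"
  shows "f \<in> borel_measurable (ref_measure K)"
  unfolding measurable_cong_sets[OF sets_ref_measure refl]
  by (rule measurable_restrict_space1[OF assms])

text \<open>The reference measure is finite and \<open>suff_stat\<close> is bounded on
  \<open>{0..K}\<close>, so Cauchy-Schwarz makes both integrands bounded.\<close>

lemma integrable_ref_measure_tilt:
  "integrable (ref_measure K) (\<lambda>y. exp (\<theta> \<bullet> suff_stat K y))"
  "integrable (ref_measure K) (\<lambda>y. y * exp (\<theta> \<bullet> suff_stat K y))"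
proof -
  interpret finite_measure "ref_measure K" by (rule finite_measure_ref_measure)
  have [measurable]: "(\<lambda>y. \<theta> \<bullet> suff_stat K y) \<in> borel_measurable borel"
    unfolding inner_suff_stat by measurable
  define C where "C = exp (norm \<theta> * (1 + K))"
  have le: "exp (\<theta> \<bullet> suff_stat K y) \<le> C" if "y \<in> {0..K}" for y
  proof -
    have "\<theta> \<bullet> suff_stat K y \<le> norm \<theta> * norm (suff_stat K y)"
      by (rule norm_cauchy_schwarz)
    also have "\<dots> \<le> norm \<theta> * (1 + K)"
      by (intro mult_left_mono norm_suff_stat_le that) simp
    finally show ?thesis by (simp add: C_def)
  qed
  show "integrable (ref_measure K) (\<lambda>y. exp (\<theta> \<bullet> suff_stat K y))"
  proof (rule integrable_const_bound[where B = C])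
    show "AE y in ref_measure K. norm (exp (\<theta> \<bullet> suff_stat K y)) \<le> C"
      using le by (intro AE_I2) simp
  qed (intro measurable_ref_measure_borel, measurable)
  show "integrable (ref_measure K) (\<lambda>y. y * exp (\<theta> \<bullet> suff_stat K y))"
  proof (rule integrable_const_bound[where B = "K * C"])
    show "AE y in ref_measure K. norm (y * exp (\<theta> \<bullet> suff_stat K y)) \<le> K * C"
      using le by (auto intro!: AE_I2 mult_mono simp: abs_mult)
  qed (intro measurable_ref_measure_borel, measurable)
qed

text \<open>The integrand is strictly positive and the atom at 0 gives the measure nonzero mass,
  even for \<open>K = 0\<close>.\<close>

lemma integral_tilt_pos:
  assumes "0 \<le> K"
  shows "0 < (LINT y|ref_measure K. exp (\<theta> \<bullet> suff_stat K y))"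
proof -
  have "space (ref_measure K) \<in> sets (ref_measure K)" by (rule sets.top)
  then have "emeasure (ref_measure K) (space (ref_measure K)) \<noteq> 0"
    using assms by (simp add: emeasure_ref_measure del: sets_ref_measure)
  then have "\<not> (AE y in ref_measure K. exp (\<theta> \<bullet> suff_stat K y) = 0)"
    by (simp add: eventually_False ae_filter_eq_bot_iff)
  then have "(LINT y|ref_measure K. exp (\<theta> \<bullet> suff_stat K y)) \<noteq> 0"
    by (subst integral_nonneg_eq_0_iff_AE) (auto simp: integrable_ref_measure_tilt)
  moreover have "0 \<le> (LINT y|ref_measure K. exp (\<theta> \<bullet> suff_stat K y))"
    by (rule Bochner_Integration.integral_nonneg) simp
  ultimately show ?thesis by linarith
qed

text \<open>The mean of the exponential-family law with natural parameter \<theta>. The indicator of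
  \<open>{0<..K}\<close> in \<open>cond_mean\<close> can be left out, since the factor
  \<open>y\<close> vanishes at 0.\<close>

definition tilted_mean :: "real \<Rightarrow> real^2 \<Rightarrow> real" where
  "tilted_mean K \<theta> = (LINT y|ref_measure K. y * exp (\<theta> \<bullet> suff_stat K y))
     / (LINT y|ref_measure K. exp (\<theta> \<bullet> suff_stat K y))"

lemma tilted_mean_mono:
  assumes K: "0 \<le> K" and le: "\<theta> $ 1 \<le> \<theta>' $ 1" "\<theta>' $ 2 \<le> \<theta> $ 2"
  shows "tilted_mean K \<theta> \<le> tilted_mean K \<theta>'"
proof -
  let ?h = "\<lambda>y. exp (\<theta> \<bullet> suff_stat K y)"
  let ?w = "\<lambda>y. exp ((\<theta>' - \<theta>) \<bullet> suff_stat K y)"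
  have hw: "?h y * ?w y = exp (\<theta>' \<bullet> suff_stat K y)" for y
    by (simp add: exp_add[symmetric] inner_diff_left)
  have mono: "mono_on {0..K} ?w"
  proof (rule mono_onI)
    fix y z :: real
    assume yz: "y \<in> {0..K}" "z \<in> {0..K}" "y \<le> z"
    \<comment> \<open>The exponent of \<open>?w\<close> is 0 at the atom and affine on
      \<open>{0<..K}\<close>. The first inequality gives monotonicity on the affine piece; the
      second, with the order of the first components, makes the jump at 0 upward.\<close>
    have "(\<theta> $ 2 - \<theta>' $ 2) * y \<le> (\<theta> $ 2 - \<theta>' $ 2) * z" "0 \<le> (\<theta> $ 2 - \<theta>' $ 2) * z"
      using yz le by (auto intro: mult_left_mono mult_nonneg_nonneg)
    then show "?w y \<le> ?w z"
      using yz le by (auto simp: inner_suff_stat indicator_def algebra_simps)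
  qed
  show ?thesis
    unfolding tilted_mean_def hw[symmetric]
    by (rule weighted_mean_mono[where p = 0 and q = K])
      (use K mono in \<open>simp_all add: hw integrable_ref_measure_tilt integral_tilt_pos\<close>)
qed

section \<open>Integrability of the unnormalized joint density\<close>

lemma finite_measure_product_ref_measure:
  assumes "finite S"
  shows "finite_measure (product_ref_measure K S)"
proof
  interpret finite_measure "ref_measure K" for K by (rule finite_measure_ref_measure)
  interpret product_sigma_finite "\<lambda>_::nat. ref_measure K"
    by standard
  have "emeasure (product_ref_measure K S) (space (product_ref_measure K S))
      = (\<Prod>i\<in>S. emeasure (ref_measure K) (space (ref_measure K)))"
    unfolding product_ref_measure_def space_PiM
    by (rule emeasure_PiM[OF assms]) (rule sets.top)
  also have "\<dots> \<noteq> \<infinity>"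
    by (simp add: power_eq_top_ennreal emeasure_finite[unfolded infinity_ennreal_def])
  finally show "emeasure (product_ref_measure K S) (space (product_ref_measure K S)) \<noteq> \<infinity>" .
qed

lemma borel_measurable_energy:
  assumes "finite S"
  shows "energy K S G a b \<beta> \<in> borel_measurable (product_ref_measure K S)"
proof -
  \<comment> \<open>Measurability is proved entrywise: inner products and matrix products are
    unfolded below into finite sums of products of these entries.\<close>
  have comp: "(\<lambda>x. suff_stat K (x i) $ k) \<in> borel_measurable (product_ref_measure K S)"
    if "i \<in> S" for i k
  proof -
    have "(\<lambda>y. suff_stat K y $ k) \<in> borel_measurable (ref_measure K)"
      using exhaust_2[of k] by (auto intro!: measurable_ref_measure_borel)
    from measurable_compose[OF measurable_component_singleton[OF that] this]
    show ?thesis by (simp add: product_ref_measure_def)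
  qed
  have single: "(\<lambda>x. v \<bullet> suff_stat K (x i)) \<in> borel_measurable (product_ref_measure K S)"
    if "i \<in> S" for i and v :: "real^2"
    unfolding inner_vec_def inner_real_def
    by (intro borel_measurable_sum borel_measurable_times borel_measurable_const comp that)
  have pair: "(\<lambda>x. suff_stat K (x i) \<bullet> (\<beta> i j *v suff_stat K (x j)))
      \<in> borel_measurable (product_ref_measure K S)"
    if "i \<in> S" "j \<in> S" for i j
    unfolding inner_vec_def inner_real_def matrix_vector_mult_def vec_lambda_beta
    by (intro borel_measurable_sum borel_measurable_times borel_measurable_const comp that)
  show ?thesis
    unfolding energy_def case_prod_unfold
    by (intro borel_measurable_add borel_measurable_sum single pair) auto
qed

text \<open>Each \<open>suff_stat\<close> value has norm at most \<open>1 + K\<close>, so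
  Cauchy-Schwarz bounds the one-site terms and the operator norm of \<open>\<beta> i j\<close>
  bounds the pair terms.\<close>

lemma bounded_energy:
  assumes "finite S"
  obtains C where "\<And>x. x \<in> S \<rightarrow>\<^sub>E {0..K} \<Longrightarrow> energy K S G a b \<beta> x \<le> C"
proof
  fix x assume x: "x \<in> S \<rightarrow>\<^sub>E {0..K}"
  let ?P = "{(i, j). i \<in> S \<and> j \<in> S \<and> (i, j) \<in> G \<and> i < j}"
  have B: "norm (suff_stat K (x i)) \<le> 1 + K" if "i \<in> S" for i
    using x that by (intro norm_suff_stat_le) auto
  have "v \<bullet> suff_stat K (x i) \<le> norm v * (1 + K)" if "i \<in> S" for v i
    using norm_cauchy_schwarz[of v "suff_stat K (x i)"] mult_left_mono[OF B[OF that], of "norm v"]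
    by simp
  moreover have "suff_stat K (x i) \<bullet> (\<beta> i j *v suff_stat K (x j))
      \<le> (1 + K) * (onorm ((*v) (\<beta> i j)) * (1 + K))" if "i \<in> S" "j \<in> S" for i j
  proof -
    have bl: "bounded_linear ((*v) (\<beta> i j))" by (rule matrix_vector_mul_bounded_linear)
    have "suff_stat K (x i) \<bullet> (\<beta> i j *v suff_stat K (x j))
        \<le> norm (suff_stat K (x i)) * norm (\<beta> i j *v suff_stat K (x j))"
      by (rule norm_cauchy_schwarz)
    also have "\<dots> \<le> norm (suff_stat K (x i)) * (onorm ((*v) (\<beta> i j)) * norm (suff_stat K (x j)))"
      by (intro mult_left_mono onorm[OF bl]) simp
    also have "\<dots> \<le> (1 + K) * (onorm ((*v) (\<beta> i j)) * (1 + K))"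
      using B[OF that(1)] B[OF that(2)] onorm_pos_le[OF bl] norm_ge_zero[of "suff_stat K (x i)"]
      by (intro mult_mono mult_nonneg_nonneg) (auto intro: order_trans[OF norm_ge_zero])
    finally show ?thesis .
  qed
  \<comment> \<open>The sum of the termwise bounds does not mention \<open>x\<close> and is the
    witness for \<open>C\<close>.\<close>
  ultimately show "energy K S G a b \<beta> x \<le> (\<Sum>i\<in>S. norm (vector [a i, b i] :: real^2) * (1 + K))
      + (\<Sum>(i, j)\<in>?P. (1 + K) * (onorm ((*v) (\<beta> i j)) * (1 + K)))"
    unfolding energy_def by (intro add_mono sum_mono) auto
qed

lemma integrable_exp_energy:
  assumes "finite S"
  shows "integrable (product_ref_measure K S) (\<lambda>x. exp (energy K S G a b \<beta> x))"
proof -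
  interpret finite_measure "product_ref_measure K S"
    by (rule finite_measure_product_ref_measure[OF assms])
  obtain C where C: "\<And>x. x \<in> S \<rightarrow>\<^sub>E {0..K} \<Longrightarrow> energy K S G a b \<beta> x \<le> C"
    using bounded_energy[OF assms] by blast
  show ?thesis
  proof (rule integrable_const_bound[where B = "exp C"])
    show "AE x in product_ref_measure K S. norm (exp (energy K S G a b \<beta> x)) \<le> exp C"
      using C by (intro AE_I2) (simp add: product_ref_measure_def space_PiM)
  qed (use borel_measurable_energy[OF assms] in measurable)
qed

section \<open>Conditional means as tilted means\<close>

text \<open>
  The normalizing constant \<open>Z\<close> of the joint density cancels; the factor \<open>Z / Z\<close> stands in place
  of \<open>1\<close> because positivity of \<open>Z\<close> is irrelevant to monotonicity.
\<close>

lemma cond_mean_eq_tilted_mean: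
  fixes K :: real and a b :: "nat \<Rightarrow> real"
  assumes "finite S" "i \<in> S" "G \<subseteq> S \<times> S" "sym G" "irrefl G"
    and "\<forall>i\<in>S. \<forall>j\<in>S. i \<noteq> j \<longrightarrow> \<beta> i j = transpose (\<beta> j i)"
  defines "Z \<equiv> (LINT z|product_ref_measure K S. exp (energy K S G a b \<beta> z))"
  shows "cond_mean K S G a b \<beta> i x = Z / Z * tilted_mean K (local_param K G a b \<beta> i x)"
proof -
  define \<theta> where "\<theta> = local_param K G a b \<beta> i x"
  \<comment> \<open>\<open>A\<close> is the joint density at \<open>x(i := 0)\<close>, where the
    statistic of site \<open>i\<close> vanishes; it carries everything independent of the
    \<open>i\<close>-th coordinate.\<close>
  define A where "A = exp (energy K S G a b \<beta> (x(i := 0))) / Z"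
  define N where "N = (LINT y|ref_measure K. exp (\<theta> \<bullet> suff_stat K y))"
  have energy: "energy K S G a b \<beta> (x(i := y)) = energy K S G a b \<beta> (x(i := 0)) + \<theta> \<bullet> suff_stat K y" for y
    using energy_fun_upd[where \<beta> = \<beta>, OF assms(1-5) assms(6)[rule_format], of K a b x y]
    by (simp add: \<theta>_def)
  have joint: "joint_density K S G a b \<beta> (x(i := y)) = A * exp (\<theta> \<bullet> suff_stat K y)" for y
    using energy[of y] by (simp add: joint_density_def A_def Z_def exp_add)
  have "cond_mean K S G a b \<beta> i x
      = (LINT y|ref_measure K. A / (A * N) * (y * exp (\<theta> \<bullet> suff_stat K y)))"
    unfolding cond_mean_def cond_density_def joint
    by (intro Bochner_Integration.integral_cong refl) (auto simp: N_def indicator_def)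
  also have "\<dots> = A / A * tilted_mean K \<theta>"
    by (simp add: tilted_mean_def N_def)
  \<comment> \<open>The exponential factor of \<open>A\<close> is nonzero and cancels; the equality
    also covers \<open>Z = 0\<close>, where division by zero makes both sides 0.\<close>
  also have "A / A = Z / Z"
    by (simp add: A_def)
  finally show ?thesis by (simp add: \<theta>_def)
qed

text \<open>The factor \<open>Z / Z\<close> is 0 or 1 and the same for both configurations, so the
  comparison reduces to that of the tilted means.\<close>

lemma cond_mean_mono:
  assumes "0 \<le> K" "finite S" "i \<in> S" "G \<subseteq> S \<times> S" "sym G" "irrefl G"
    and "\<forall>i\<in>S. \<forall>j\<in>S. i \<noteq> j \<longrightarrow> \<beta> i j = transpose (\<beta> j i)"
    and "local_param K G a b \<beta> i x $ 1 \<le> local_param K G a b \<beta> i x' $ 1"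
    and "local_param K G a b \<beta> i x' $ 2 \<le> local_param K G a b \<beta> i x $ 2"
  shows "cond_mean K S G a b \<beta> i x \<le> cond_mean K S G a b \<beta> i x'"
  unfolding cond_mean_eq_tilted_mean[OF assms(2-7)]
  by (intro mult_left_mono tilted_mean_mono assms) simp

section \<open>Natural parameters as functions of the neighbouring values\<close>

lemma local_param_2_ge:
  assumes x: "\<And>j. j \<in> neighbours G i \<Longrightarrow> x j \<in> {0..K}"
  shows "b i + (\<Sum>j\<in>neighbours G i. min 0 (min (\<beta> i j $ 2 $ 1) (\<beta> i j $ 2 $ 1 - \<beta> i j $ 2 $ 2 * K)))
    \<le> local_param K G a b \<beta> i x $ 2"
proof -
  \<comment> \<open>A neighbour contributes 0 when its value is 0, and otherwise an affine function
    of its value, which is at least the smaller of its endpoint values at 0 and \<open>K\<close>.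
    These are the three terms of the minimum.\<close>
  have "min 0 (min (\<beta> i j $ 2 $ 1) (\<beta> i j $ 2 $ 1 - \<beta> i j $ 2 $ 2 * K))
      \<le> \<beta> i j $ 2 $ 1 * indicator {0<..K} (x j) - \<beta> i j $ 2 $ 2 * x j * indicator {0<..K} (x j)"
    if j: "j \<in> neighbours G i" for j
  proof -
    have "\<beta> i j $ 2 $ 2 * x j \<le> max 0 (\<beta> i j $ 2 $ 2 * K)"
    proof (cases "0 \<le> \<beta> i j $ 2 $ 2")
      case True
      then have "\<beta> i j $ 2 $ 2 * x j \<le> \<beta> i j $ 2 $ 2 * K"
        using x[OF j] by (intro mult_left_mono) auto
      then show ?thesis by simp
    next
      case False
      then have "\<beta> i j $ 2 $ 2 * x j \<le> 0"
        using x[OF j] by (intro mult_nonpos_nonneg) auto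
      then show ?thesis by simp
    qed
    then show ?thesis by (auto simp: indicator_def)
  qed
  then show ?thesis
    by (simp add: local_param_def sum_mono)
qed

text \<open>On \<open>{0<..K}\<close> the indicator is constantly 1, so each component is affine in
  the moved coordinate, with slope minus the second-column entry of \<open>\<beta> i j\<close> if
  \<open>j\<close> is a neighbour and the neighbourhood is finite.\<close>

lemma local_param_fun_upd_mono:
  assumes u: "u \<in> {0<..K}" "v \<in> {0<..K}" "u \<le> v"
  shows "\<beta> i j $ k $ 2 \<le> 0 \<Longrightarrow>
      local_param K G a b \<beta> i (x(j := u)) $ k \<le> local_param K G a b \<beta> i (x(j := v)) $ k"
    and "0 \<le> \<beta> i j $ k $ 2 \<Longrightarrow>
      local_param K G a b \<beta> i (x(j := v)) $ k \<le> local_param K G a b \<beta> i (x(j := u)) $ k"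
proof -
  \<comment> \<open>Writing the increment as a sum with a conditional avoids a case split: the sum
    is 0 when \<open>j\<close> is not a neighbour or the neighbourhood is infinite, and its sign is
    clear in every case.\<close>
  have shift: "local_param K G a b \<beta> i (x(j := v)) $ k = local_param K G a b \<beta> i (x(j := u)) $ k
      - (\<Sum>l\<in>neighbours G i. if l = j then \<beta> i j $ k $ 2 * (v - u) else 0)" for k
  proof -
    have "(\<Sum>l\<in>neighbours G i. \<beta> i l $ k $ 1 * indicator {0<..K} ((x(j := v)) l)
          - \<beta> i l $ k $ 2 * (x(j := v)) l * indicator {0<..K} ((x(j := v)) l))
        = (\<Sum>l\<in>neighbours G i. (\<beta> i l $ k $ 1 * indicator {0<..K} ((x(j := u)) l)
          - \<beta> i l $ k $ 2 * (x(j := u)) l * indicator {0<..K} ((x(j := u)) l))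
          - (if l = j then \<beta> i j $ k $ 2 * (v - u) else 0))"
      using u by (intro sum.cong refl) (auto simp: algebra_simps)
    then show ?thesis
      using exhaust_2[of k] by (auto simp: local_param_def sum_subtractf)
  qed
  show "\<beta> i j $ k $ 2 \<le> 0 \<Longrightarrow>
      local_param K G a b \<beta> i (x(j := u)) $ k \<le> local_param K G a b \<beta> i (x(j := v)) $ k"
    unfolding shift using u by (auto intro!: sum_nonpos mult_nonpos_nonneg)
  show "0 \<le> \<beta> i j $ k $ 2 \<Longrightarrow>
      local_param K G a b \<beta> i (x(j := v)) $ k \<le> local_param K G a b \<beta> i (x(j := u)) $ k"
    unfolding shift using u by (auto intro!: sum_nonneg mult_nonneg_nonneg)
qed

section \<open>Well-definedness, cooperation and competition\<close>

theorem proposition2: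
  fixes n :: nat and K :: real and S :: "nat set" and G :: "(nat \<times> nat) set"
    and a b :: "nat \<Rightarrow> real"
    and c d f e :: "nat \<Rightarrow> nat \<Rightarrow> real"
    and \<beta> :: "nat \<Rightarrow> nat \<Rightarrow> real^2^2"
  assumes K: "K > 0"
    and S: "S = {1..n}"
    and graph: "G \<subseteq> S \<times> S" "sym G" "irrefl G"
    and beta: "\<forall>i\<in>S. \<forall>j\<in>S. i \<noteq> j \<longrightarrow>
      \<beta> i j = vector [vector [c i j, d i j], vector [f i j, e i j]]"
    and beta_transpose: "\<forall>i\<in>S. \<forall>j\<in>S. i \<noteq> j \<longrightarrow> \<beta> i j = transpose (\<beta> j i)"
    and beta_zero: "\<forall>i\<in>S. \<forall>j\<in>S. i \<noteq> j \<longrightarrow> j \<notin> neighbours G i \<longrightarrow> \<beta> i j = 0"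
    and positivity: "\<forall>i\<in>S. b i + (\<Sum>j\<in>neighbours G i.
      min 0 (min (f i j) (f i j - e i j * K))) > 0"
  shows "well_defined_model K S G a b \<beta> \<and>
    ((\<forall>i\<in>S. \<forall>j\<in>S. i \<noteq> j \<longrightarrow> d i j \<le> 0 \<and> e i j \<ge> 0) \<longrightarrow> spatially_cooperative K S G a b \<beta>) \<and>
    ((\<forall>i\<in>S. \<forall>j\<in>S. i \<noteq> j \<longrightarrow> d i j \<ge> 0 \<and> e i j \<le> 0) \<longrightarrow> spatially_competitive K S G a b \<beta>)"
proof (intro conjI impI)
  have fin: "finite S" by (simp add: S)
  have K0: "0 \<le> K" using K by simp
  have nb: "i \<in> S \<and> j \<in> S \<and> i \<noteq> j" if "j \<in> neighbours G i" for i j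
    using that graph by (auto simp: neighbours_def irrefl_def)
  have entries: "\<beta> i j $ 1 $ 2 = d i j" "\<beta> i j $ 2 $ 1 = f i j" "\<beta> i j $ 2 $ 2 = e i j"
    if "j \<in> neighbours G i" for i j
    using bspec[OF bspec[OF beta], of i j] nb[OF that] by simp_all
  \<comment> \<open>What remains to be supplied is \<open>i \<in> S\<close> and the two inequalities
    between natural parameters: first component up, second component down.\<close>
  note le = cond_mean_mono[OF K0 fin _ graph beta_transpose]
  show "well_defined_model K S G a b \<beta>"
    unfolding well_defined_model_def
  proof (intro conjI ballI)
    show "integrable (product_ref_measure K S) (\<lambda>x. exp (energy K S G a b \<beta> x))"
      by (rule integrable_exp_energy[OF fin])
  next
    fix i x assume i: "i \<in> S" and x: "x \<in> S \<rightarrow>\<^sub>E {0..K}"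
    have "0 < b i + (\<Sum>j\<in>neighbours G i. min 0 (min (f i j) (f i j - e i j * K)))"
      using positivity i by blast
    also have "\<dots> = b i + (\<Sum>j\<in>neighbours G i.
        min 0 (min (\<beta> i j $ 2 $ 1) (\<beta> i j $ 2 $ 1 - \<beta> i j $ 2 $ 2 * K)))"
      by (simp add: entries)
    also have "\<dots> \<le> local_param K G a b \<beta> i x $ 2"
      by (rule local_param_2_ge) (use nb x in blast)
    finally show "0 < local_param K G a b \<beta> i x $ 2" .
  qed
  show "spatially_cooperative K S G a b \<beta>"
    if "\<forall>i\<in>S. \<forall>j\<in>S. i \<noteq> j \<longrightarrow> d i j \<le> 0 \<and> e i j \<ge> 0"
    unfolding spatially_cooperative_def
  proof (intro ballI mono_onI)
    fix i j x and u v :: real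
    assume j: "j \<in> neighbours G i" and uv: "u \<in> {0<..K}" "v \<in> {0<..K}" "u \<le> v"
    have "i \<in> S" "\<beta> i j $ 1 $ 2 \<le> 0" "0 \<le> \<beta> i j $ 2 $ 2"
      unfolding entries[OF j] using that nb[OF j] by blast+
    \<comment> \<open>As the neighbour's value grows, \<open>d i j \<le> 0\<close> raises the first
      component and \<open>e i j \<ge> 0\<close> lowers the second.\<close>
    then show "cond_mean K S G a b \<beta> i (x(j := u)) \<le> cond_mean K S G a b \<beta> i (x(j := v))"
      by (intro le local_param_fun_upd_mono(1)[OF uv] local_param_fun_upd_mono(2)[OF uv])
  qed
  show "spatially_competitive K S G a b \<beta>"
    if "\<forall>i\<in>S. \<forall>j\<in>S. i \<noteq> j \<longrightarrow> d i j \<ge> 0 \<and> e i j \<le> 0"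
    unfolding spatially_competitive_def
  proof (intro ballI monotone_onI)
    fix i j x and u v :: real
    assume j: "j \<in> neighbours G i" and uv: "u \<in> {0<..K}" "v \<in> {0<..K}" "u \<le> v"
    have "i \<in> S" "0 \<le> \<beta> i j $ 1 $ 2" "\<beta> i j $ 2 $ 2 \<le> 0"
      unfolding entries[OF j] using that nb[OF j] by blast+
    \<comment> \<open>The reversed signs move both components the other way, so \<open>le\<close>
      applies with the roles of \<open>u\<close> and \<open>v\<close> exchanged.\<close>
    then show "cond_mean K S G a b \<beta> i (x(j := v)) \<le> cond_mean K S G a b \<beta> i (x(j := u))"
      by (intro le local_param_fun_upd_mono(1)[OF uv] local_param_fun_upd_mono(2)[OF uv])
  qed
qed

end
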